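(* Let $\mathsf G$ be a connected finite combinatorial graph (multiple edges allowed, no loops) with $V\ge 2$ vertices and edge connectivity $\eta$. Let $\mathsf P_V$ be the path graph on $V$ vertices and let $\widetilde{\mathsf G}$ be the $\eta$-regular pumpkin chain on $V$ vertices. Then for every $p\in(1,\infty)$ $$\gamma_1^{(p)}(\mathsf G)\ \ge\ \gamma_1^{(p)}(\widetilde{\mathsf G})\ =\ \eta\,\gamma_1^{(p)}(\mathsf P_V).$$ Equality $\gamma_1^{(p)}(\mathsf G)=\gamma_1^{(p)}(\widetilde{\mathsf G})$ holds if and only if $\mathsf G$ is an $\eta$-regular pumpkin chain.
   Context: A combinatorial graph $\mathsf G$ has a finite vertex set $\mathsf V$ (with $V=\#\mathsf V$) and a finite edge set $\mathsf E$; several edges may join the same pair of vertices, loops are not allowed, and the graph is connected. The edge connectivity $\eta$ is the minimal number of edges whose removal disconnects $\mathsf G$. Fix an arbitrary orientation of the edges, with $\mathsf e_{init},\mathsf e_{term}$ the initial and terminal endpoints of $\mathsf e\in\mathsf E$. The first nontrivial eigenvalue of the discrete $p$-Laplacian is $$\gamma_1^{(p)}(\mathsf G):=\inf\left\{\frac{\sum_{\mathsf e\in\mathsf E}|f(\mathsf e_{init})-f(\mathsf e_{term})|^p}{\inf_{\gamma\in\mathbb R}\sum_{\mathsf v\in\mathsf V}|f(\mathsf v)-\gamma|^p}\ :\ f\in\mathbb R^{\mathsf V}\text{ non-constant}\right\}.$$ The path graph $\mathsf P_V$ has vertices $\mathsf v_1,\dots,\mathsf v_V$ and exactly one edge between $\mathsf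 v_i$ and $\mathsf v_{i+1}$ for $1\le i\le V-1$, and no other edges. For an integer $k\ge1$, the $k$-regular pumpkin chain on $V$ vertices is the graph obtained from $\mathsf P_V$ by replacing each edge by exactly $k$ parallel edges with the same endpoints. *)

theory Defs
  imports Complex_Main "Graph_Theory.Digraph_Component"
begin

text \<open>
  An undirected multigraph is represented by a multi-digraph of the library, i.e. by the multigraph
  together with an arbitrary orientation of its edges: an edge e has initial endpoint tail G e and
  terminal endpoint head G e. Parallel edges may carry opposite orientations. The library's
  \<^const>\<open>Digraph_Component.connected\<close> ignores orientations; it is written qualified
  because of the topological constant of the same name.
\<close>

locale combinatorial_graph = fin_digraph G + loopfree_digraph G
  for G :: "('a, 'b) pre_digraph" +
  assumes connected_graph: "Digraph_Component.connected G"

definition del_arcs :: "('a, 'b) pre_digraph \<Rightarrow> 'b set \<Rightarrow> ('a, 'b) pre_digraph" where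
  "del_arcs G F = \<lparr> verts = verts G, arcs = arcs G - F, tail = tail G, head = head G \<rparr>"

text \<open>
  The set of cardinalities below is nonempty whenever a finite graph has at least two vertices,
  since then removing all edges disconnects it.
\<close>

definition edge_connectivity :: "('a, 'b) pre_digraph \<Rightarrow> nat" where
  "edge_connectivity G =
     Inf {card F | F. F \<subseteq> arcs G \<and> \<not> Digraph_Component.connected (del_arcs G F)}"

text \<open>
  In the next definition, only the values of f on verts G matter, so f ranges over all functions
  on the ambient type. For non-constant f on a finite vertex set, the inner infimum is positive.
\<close>

definition gamma1 :: "real \<Rightarrow> ('a, 'b) pre_digraph \<Rightarrow> real" where
  "gamma1 p G =
     Inf {(\<Sum>e\<in>arcs G. \<bar>f (tail G e) - f (head G e)\<bar> powr p) /
          (INF c::real. \<Sum>v\<in>verts G. \<bar>f v - c\<bar> powr p) | f :: 'a \<Rightarrow> real.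
          \<not> (\<exists>c. \<forall>v\<in>verts G. f v = c)}"

definition path_graph :: "nat \<Rightarrow> (nat, nat) pre_digraph" where
  "path_graph n = \<lparr> verts = {1..n}, arcs = {1..<n}, tail = (\<lambda>i. i), head = (\<lambda>i. i + 1) \<rparr>"

definition replace_edges_parallel ::
  "nat \<Rightarrow> ('a, 'b) pre_digraph \<Rightarrow> ('a, 'b \<times> nat) pre_digraph" where
  "replace_edges_parallel k G =
     \<lparr> verts = verts G, arcs = arcs G \<times> {1..k},
       tail = (\<lambda>(e, j). tail G e), head = (\<lambda>(e, j). head G e) \<rparr>"

definition pumpkin_chain :: "nat \<Rightarrow> nat \<Rightarrow> (nat, nat \<times> nat) pre_digraph" where
  "pumpkin_chain k n = replace_edges_parallel k (path_graph n)"

text \<open>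
  Isomorphism of undirected multigraphs, disregarding the chosen orientations; the library's
  digraph_iso respects them.
\<close>

definition multigraph_iso :: "('a, 'b) pre_digraph \<Rightarrow> ('c, 'd) pre_digraph \<Rightarrow> bool" where
  "multigraph_iso G H \<longleftrightarrow>
     (\<exists>\<phi> \<psi>. bij_betw \<phi> (verts G) (verts H) \<and> bij_betw \<psi> (arcs G) (arcs H) \<and>
        (\<forall>e\<in>arcs G. {\<phi> (tail G e), \<phi> (head G e)} = {tail H (\<psi> e), head H (\<psi> e)}))"

definition is_pumpkin_chain :: "nat \<Rightarrow> ('a, 'b) pre_digraph \<Rightarrow> bool" where
  "is_pumpkin_chain k G \<longleftrightarrow> multigraph_iso G (pumpkin_chain k (card (verts G)))"

end

theory Submission
  imports Defs "HOL-Analysis.Convex"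
begin

text \<open>
  Sort the vertices of \<^term>\<open>G\<close> by the values of a test function \<open>f\<close>, and let \<open>g\<close> be the
  nondecreasing list of these values, regarded as a function on the path graph. An edge whose
  endpoints have ranks \<open>i < j\<close> contributes \<open>(d\<^sub>i + \<dots> + d\<^sub>j\<^sub>-\<^sub>1) powr p\<close> to the energy of \<open>f\<close>, where
  \<open>d\<^sub>k = g (Suc k) - g k\<close>; as \<open>p > 1\<close>, this is at least the sum of the \<open>d\<^sub>k powr p\<close>. Summing over
  all edges counts \<open>d\<^sub>k powr p\<close> once for every edge crossing the cut between the \<open>k\<close> smallest
  vertices and the others, hence at least \<open>\<eta>\<close> times, where \<open>\<eta>\<close> is the edge connectivity. So the
  energy of \<open>f\<close> is at least \<open>\<eta>\<close> times the path energy of \<open>g\<close> (\<open>energy_ge_energy_path\<close>). The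
  denominator of the Rayleigh quotient only depends on the multiset of values, so it is unchanged
  by sorting, and the inequality follows. Multiplying every edge by \<open>\<eta>\<close> multiplies the energy by
  \<open>\<eta>\<close>, which identifies the eigenvalue of the pumpkin chain.

  For the equality case, the infimum for \<open>G\<close> is attained by some \<open>f\<close>, by compactness
  (\<open>gamma1_attained\<close>). If the two eigenvalues agree, every estimate above is sharp for this \<open>f\<close>. In
  particular \<open>g\<close> minimizes the quotient on the path, and a nondecreasing minimizer on the path is
  strictly increasing (\<open>path_minimizer_strictly_increasing\<close>): pulling the two sides of a zero gap
  apart by \<open>t\<close> costs only \<open>t powr p\<close> in energy but gains a positive multiple of \<open>t\<close> in the
  denominator. With all gaps positive, sharpness says that every edge crosses exactly one gap, i.e.
  joins vertices of consecutive ranks, and that every gap is crossed by exactly \<open>\<eta>\<close> edges. This is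
  a pumpkin chain.
\<close>

section \<open>Powers with exponent greater than one\<close>

text \<open>
  Up to the factor \<open>p\<close>, this is the derivative of \<open>\<lambda>x. \<bar>x\<bar> powr p\<close> when \<open>q = p - 1\<close>.
\<close>
definition signed_powr :: "real \<Rightarrow> real \<Rightarrow> real" where
  "signed_powr q x = sgn x * \<bar>x\<bar> powr q"

text \<open>
  This form makes monotonicity and continuity visible: for \<open>q > 0\<close>, each summand is a composition
  of monotone, respectively continuous, functions.
\<close>
lemma signed_powr_eq_diff: "signed_powr q x = max x 0 powr q - max (- x) 0 powr q"
  by (auto simp: signed_powr_def sgn_if max_def)

lemma signed_powr_mono: "q > 0 \<Longrightarrow> x \<le> y \<Longrightarrow> signed_powr q x \<le> signed_powr q y"
  unfolding signed_powr_eq_diff by (intro diff_mono powr_mono2) auto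

lemma signed_powr_eq_0_iff [simp]: "signed_powr q x = 0 \<longleftrightarrow> x = 0"
  by (simp add: signed_powr_def sgn_if)

lemma continuous_on_signed_powr:
  assumes "q > 0"
  shows "continuous_on UNIV (signed_powr q)"
proof -
  have "continuous_on UNIV (\<lambda>x. max x 0 powr q - max (- x) 0 powr q)"
    using assms by (intro continuous_on_diff continuous_on_powr' continuous_intros) auto
  then show ?thesis
    by (simp add: signed_powr_eq_diff[abs_def])
qed

text \<open>
  The graph of the convex function \<open>\<lambda>x. \<bar>x\<bar> powr p\<close> lies above its tangent at \<open>a\<close>. After
  \<open>sgn a * x \<le> \<bar>x\<bar>\<close>, this is Young's inequality for \<open>\<bar>x\<bar>\<close> and \<open>\<bar>a\<bar> powr (p - 1)\<close> with the
  conjugate exponents \<open>p\<close> and \<open>p / (p - 1)\<close>.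
\<close>
lemma abs_powr_tangent:
  fixes p x a :: real
  assumes p: "p > 1"
  shows "\<bar>a\<bar> powr p + p * signed_powr (p - 1) a * (x - a) \<le> \<bar>x\<bar> powr p"
proof -
  let ?b = "\<bar>a\<bar> powr (p - 1)"
  have "\<bar>x\<bar> * ?b \<le> \<bar>x\<bar> powr p / p + ?b powr (p / (p - 1)) / (p / (p - 1))"
    using p by (intro Youngs_inequality) (auto simp: field_simps)
  also have "?b powr (p / (p - 1)) = \<bar>a\<bar> powr p"
    using p by (simp add: powr_powr)
  finally have young: "p * (\<bar>x\<bar> * ?b) \<le> \<bar>x\<bar> powr p + (p - 1) * \<bar>a\<bar> powr p"
    using p by (simp add: field_simps)
  have "sgn a * x \<le> \<bar>x\<bar>"
    by (auto simp: sgn_if)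
  then have "sgn a * x * ?b \<le> \<bar>x\<bar> * ?b"
    by (intro mult_right_mono) auto
  then have "p * (sgn a * x * ?b) \<le> p * (\<bar>x\<bar> * ?b)"
    using p by (intro mult_left_mono) auto
  moreover have "signed_powr (p - 1) a * a = \<bar>a\<bar> powr p"
  proof (cases "a = 0")
    case False
    have "sgn a * ?b * a = \<bar>a\<bar> * ?b"
      by (simp add: abs_sgn)
    also have "\<dots> = \<bar>a\<bar> powr p"
      using powr_mult_base[of "\<bar>a\<bar>" "p - 1"] by simp
    finally show ?thesis
      by (simp add: signed_powr_def)
  qed simp
  ultimately show ?thesis
    using young by (simp add: signed_powr_def algebra_simps)
qed

text \<open>
  With \<open>s\<close> the sum of the \<open>d k\<close>, write \<open>d k powr p = d k * d k powr (p - 1)\<close> and bound the second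
  factor by \<open>s powr (p - 1)\<close>.
\<close>
lemma sum_powr_le_powr_sum:
  fixes p :: real and d :: "'i \<Rightarrow> real"
  assumes "p > 1" "finite K" "\<And>k. k \<in> K \<Longrightarrow> 0 \<le> d k"
  shows "(\<Sum>k\<in>K. d k powr p) \<le> (\<Sum>k\<in>K. d k) powr p"
proof -
  define s where "s = (\<Sum>k\<in>K. d k)"
  have s: "0 \<le> s"
    unfolding s_def using assms(3) by (rule sum_nonneg)
  have "(\<Sum>k\<in>K. d k powr p) \<le> (\<Sum>k\<in>K. d k * s powr (p - 1))"
  proof (rule sum_mono)
    fix k assume k: "k \<in> K"
    have "d k \<le> s"
      unfolding s_def using k assms by (intro member_le_sum) auto
    then have "d k * d k powr (p - 1) \<le> d k * s powr (p - 1)"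
      using assms(1) assms(3)[OF k] by (intro mult_left_mono powr_mono2) auto
    then show "d k powr p \<le> d k * s powr (p - 1)"
      using powr_mult_base[OF assms(3)[OF k], of "p - 1"] by simp
  qed
  also have "\<dots> = s * s powr (p - 1)"
    by (simp add: s_def sum_distrib_right)
  also have "\<dots> = s powr p"
    using powr_mult_base[OF s, of "p - 1"] by simp
  finally show ?thesis
    by (simp add: s_def)
qed

text \<open>
  As soon as there are two positive summands, each of them is smaller than the total, so the
  estimate by \<open>s powr (p - 1)\<close> is strict.
\<close>
lemma sum_powr_less_powr_sum:
  fixes p :: real and d :: "'i \<Rightarrow> real"
  assumes p: "p > 1" and fin: "finite K" and pos: "\<And>k. k \<in> K \<Longrightarrow> 0 < d k"
    and card: "2 \<le> card K"
  shows "(\<Sum>k\<in>K. d k powr p) < (\<Sum>k\<in>K. d k) powr p"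
proof -
  define s where "s = (\<Sum>k\<in>K. d k)"
  have s: "0 \<le> s"
    unfolding s_def using pos by (intro sum_nonneg) (simp add: less_imp_le)
  have "(\<Sum>k\<in>K. d k powr p) < (\<Sum>k\<in>K. d k * s powr (p - 1))"
  proof (rule sum_strict_mono)
    fix k assume k: "k \<in> K"
    have "card (K - {k}) \<noteq> 0"
      using card k fin by simp
    then have "K - {k} \<noteq> {}"
      by force
    then have "0 < (\<Sum>j\<in>K - {k}. d j)"
      using pos fin by (intro sum_pos) auto
    then have "d k < s"
      unfolding s_def using sum.remove[OF fin k, of d] by simp
    then have "d k * d k powr (p - 1) < d k * s powr (p - 1)"
      using p pos[OF k] by (intro mult_strict_left_mono powr_less_mono2) auto
    then show "d k powr p < d k * s powr (p - 1)"
      using powr_mult_base[of "d k" "p - 1"] pos[OF k] by simp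
  qed (use card fin in auto)
  also have "\<dots> = s * s powr (p - 1)"
    by (simp add: s_def sum_distrib_right)
  also have "\<dots> = s powr p"
    using powr_mult_base[OF s, of "p - 1"] by simp
  finally show ?thesis
    by (simp add: s_def)
qed

section \<open>The Rayleigh quotient and its minimizers\<close>

definition edge_energy :: "real \<Rightarrow> ('a, 'b) pre_digraph \<Rightarrow> ('a \<Rightarrow> real) \<Rightarrow> real" where
  "edge_energy p G f = (\<Sum>e\<in>arcs G. \<bar>f (tail G e) - f (head G e)\<bar> powr p)"

definition deviation :: "real \<Rightarrow> 'a set \<Rightarrow> ('a \<Rightarrow> real) \<Rightarrow> real" where
  "deviation p S f = (INF c::real. \<Sum>v\<in>S. \<bar>f v - c\<bar> powr p)"

definition nonconst_on :: "'a set \<Rightarrow> ('a \<Rightarrow> real) \<Rightarrow> bool" where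
  "nonconst_on S f \<longleftrightarrow> (\<exists>u\<in>S. \<exists>v\<in>S. f u \<noteq> f v)"

lemma not_const_iff_nonconst_on:
  "(\<not> (\<exists>c. \<forall>v\<in>S. f v = c)) \<longleftrightarrow> nonconst_on S f"
  unfolding nonconst_on_def by metis

lemma gamma1_eq_Inf_quotients:
  "gamma1 p G = Inf {edge_energy p G f / deviation p (verts G) f | f. nonconst_on (verts G) f}"
  unfolding gamma1_def edge_energy_def deviation_def not_const_iff_nonconst_on ..

lemma edge_energy_nonneg: "0 \<le> edge_energy p G f"
  unfolding edge_energy_def by (rule sum_nonneg) simp

lemma deviation_le: "deviation p S f \<le> (\<Sum>v\<in>S. \<bar>f v - c\<bar> powr p)"
  unfolding deviation_def
  by (rule cINF_lower) (auto intro!: bdd_belowI[of _ 0] sum_nonneg)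

lemma deviation_greatest:
  "(\<And>c. t \<le> (\<Sum>v\<in>S. \<bar>f v - c\<bar> powr p)) \<Longrightarrow> t \<le> deviation p S f"
  unfolding deviation_def by (rule cINF_greatest) auto

lemma deviation_nonneg: "0 \<le> deviation p S f"
  by (rule deviation_greatest) (simp add: sum_nonneg)

text \<open>
  Whatever the centre \<open>c\<close>, one of two distinct values of \<open>f\<close> is at least half their difference
  away from it.
\<close>
lemma deviation_pos:
  assumes "finite S" "nonconst_on S f" "p > 0"
  shows "0 < deviation p S f"
proof -
  obtain u v where uv: "u \<in> S" "v \<in> S" "f u \<noteq> f v"
    using assms(2) unfolding nonconst_on_def by blast
  have "(\<bar>f u - f v\<bar> / 2) powr p \<le> deviation p S f"
  proof (rule deviation_greatest)
    fix c :: real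
    have "\<exists>w\<in>S. \<bar>f u - f v\<bar> / 2 \<le> \<bar>f w - c\<bar>"
    proof (cases "\<bar>f u - f v\<bar> / 2 \<le> \<bar>f u - c\<bar>")
      case False
      moreover have "\<bar>f u - f v\<bar> \<le> \<bar>f u - c\<bar> + \<bar>f v - c\<bar>"
        by linarith
      moreover have "A / 2 \<le> C" if "\<not> A / 2 \<le> B" "A \<le> B + C" for A B C :: real
        using that by linarith
      ultimately have "\<bar>f u - f v\<bar> / 2 \<le> \<bar>f v - c\<bar>"
        by blast
      then show ?thesis using uv(2) by blast
    qed (use uv(1) in blast)
    then obtain w where w: "w \<in> S" "\<bar>f u - f v\<bar> / 2 \<le> \<bar>f w - c\<bar>" ..
    have "(\<bar>f u - f v\<bar> / 2) powr p \<le> \<bar>f w - c\<bar> powr p"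
      using w(2) assms(3) by (intro powr_mono2) auto
    also have "\<dots> \<le> (\<Sum>v\<in>S. \<bar>f v - c\<bar> powr p)"
      using w(1) assms(1) by (intro member_le_sum) auto
    finally show "(\<bar>f u - f v\<bar> / 2) powr p \<le> (\<Sum>v\<in>S. \<bar>f v - c\<bar> powr p)" .
  qed
  moreover have "0 < (\<bar>f u - f v\<bar> / 2) powr p"
    using uv(3) by simp
  ultimately show ?thesis by linarith
qed

lemma deviation_reindex:
  assumes "bij_betw r S T" "\<And>v. v \<in> S \<Longrightarrow> f v = g (r v)"
  shows "deviation p S f = deviation p T g"
proof -
  have "(\<Sum>v\<in>S. \<bar>f v - c\<bar> powr p) = (\<Sum>w\<in>T. \<bar>g w - c\<bar> powr p)" for c
    using sum.reindex_bij_betw[OF assms(1), of "\<lambda>w. \<bar>g w - c\<bar> powr p"] assms(2) by simp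
  then show ?thesis
    by (simp add: deviation_def)
qed

lemma nonconst_on_reindex:
  assumes "bij_betw r S T" "\<And>v. v \<in> S \<Longrightarrow> f v = g (r v)"
  shows "nonconst_on S f \<longleftrightarrow> nonconst_on T g"
  using assms unfolding nonconst_on_def bij_betw_def by auto

lemma ex_nonconst_on:
  assumes "2 \<le> card S"
  obtains f where "nonconst_on S f"
proof -
  have "finite S"
    using assms card.infinite by fastforce
  then obtain u v where "u \<in> S" "v \<in> S" "u \<noteq> v"
    using assms card_le_Suc0_iff_eq[of S] by fastforce
  then have "nonconst_on S (\<lambda>w. if w = u then 1 else 0)"
    unfolding nonconst_on_def by (intro bexI[of _ u] bexI[of _ v]) auto
  then show ?thesis by (rule that)
qed

text \<open>
  This lemma and \<open>gamma1_greatest\<close> express that \<^const>\<open>gamma1\<close> is the largest constant in a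
  Poincare inequality. The later comparisons use only this form, without quotients or infima.
\<close>
lemma gamma1_mult_deviation_le:
  assumes "finite (verts G)" "p > 0" "nonconst_on (verts G) f"
  shows "gamma1 p G * deviation p (verts G) f \<le> edge_energy p G f"
proof -
  have "gamma1 p G \<le> edge_energy p G f / deviation p (verts G) f"
    unfolding gamma1_eq_Inf_quotients
    by (rule cInf_lower)
       (use assms in \<open>auto intro!: bdd_belowI[of _ 0] divide_nonneg_nonneg edge_energy_nonneg
          deviation_nonneg\<close>)
  then show ?thesis
    using deviation_pos[OF assms(1,3,2)] by (simp add: field_simps)
qed

lemma gamma1_greatest:
  assumes "finite (verts G)" "2 \<le> card (verts G)" "p > 0"
    and "\<And>f. nonconst_on (verts G) f \<Longrightarrow> t * deviation p (verts G) f \<le> edge_energy p G f"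
  shows "t \<le> gamma1 p G"
  unfolding gamma1_eq_Inf_quotients
proof (rule cInf_greatest)
  obtain f where "nonconst_on (verts G) f"
    using ex_nonconst_on[OF assms(2)] .
  then show "{edge_energy p G f / deviation p (verts G) f |f. nonconst_on (verts G) f} \<noteq> {}"
    by blast
next
  fix x assume "x \<in> {edge_energy p G f / deviation p (verts G) f |f. nonconst_on (verts G) f}"
  then obtain f where f: "x = edge_energy p G f / deviation p (verts G) f" "nonconst_on (verts G) f"
    by blast
  show "t \<le> x"
    using assms(4)[OF f(2)] deviation_pos[OF assms(1) f(2) assms(3)]
    by (simp add: f(1) field_simps)
qed

lemma bounded_real_subseq_convergent:
  fixes x :: "nat \<Rightarrow> real"
  assumes "\<And>k. \<bar>x k\<bar> \<le> B"
  obtains s l where "strict_mono (s :: nat \<Rightarrow> nat)" "(\<lambda>k. x (s k)) \<longlonglongrightarrow> l"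
proof -
  obtain s :: "nat \<Rightarrow> nat" where s: "strict_mono s" "monoseq (\<lambda>k. x (s k))"
    using seq_monosub by blast
  have "Bseq (\<lambda>k. x (s k))"
    using assms by (intro BseqI'[of _ B]) simp
  then have "convergent (\<lambda>k. x (s k))"
    using s(2) by (rule Bseq_monoseq_convergent)
  then show ?thesis
    using s(1) that unfolding convergent_def by blast
qed

text \<open>
  Bolzano-Weierstrass for functions on a finite set, thinning the sequence once for every
  point.
\<close>
lemma bounded_functions_subseq_pointwise:
  fixes x :: "nat \<Rightarrow> 'a \<Rightarrow> real"
  assumes "finite S" "\<And>k v. v \<in> S \<Longrightarrow> \<bar>x k v\<bar> \<le> B"
  shows "\<exists>s l. strict_mono (s :: nat \<Rightarrow> nat) \<and> (\<forall>v\<in>S. (\<lambda>k. x (s k) v) \<longlonglongrightarrow> l v)"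
  using assms
proof (induction S rule: finite_induct)
  case empty
  show ?case by (intro exI[of _ id]) (auto simp: strict_mono_def)
next
  case (insert w S)
  then obtain s l where sl: "strict_mono (s :: nat \<Rightarrow> nat)" "\<forall>v\<in>S. (\<lambda>k. x (s k) v) \<longlonglongrightarrow> l v"
    by auto
  obtain s' b where s': "strict_mono (s' :: nat \<Rightarrow> nat)" "(\<lambda>k. x (s (s' k)) w) \<longlonglongrightarrow> b"
    using bounded_real_subseq_convergent[of "\<lambda>k. x (s k) w" B] insert.prems by auto
  have "(\<lambda>k. x ((s \<circ> s') k) v) \<longlonglongrightarrow> (l(w := b)) v" if "v \<in> insert w S" for v
  proof (cases "v = w")
    case False
    then have "(\<lambda>k. x (s k) v) \<longlonglongrightarrow> l v"
      using sl(2) that by blast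
    from LIMSEQ_subseq_LIMSEQ[OF this s'(1)] show ?thesis
      using False by (simp add: o_def)
  qed (use s'(2) in simp)
  then show ?case
    using strict_mono_o[OF sl(1) s'(1)] by blast
qed

lemma edge_energy_affine:
  assumes "s > 0"
  shows "edge_energy p G (\<lambda>v. (f v - a) / s) = edge_energy p G f / s powr p"
proof -
  have "\<bar>(f u - a) / s - (f v - a) / s\<bar> powr p = \<bar>f u - f v\<bar> powr p / s powr p" for u v
    using assms by (simp flip: diff_divide_distrib add: powr_divide)
  then show ?thesis
    by (simp add: edge_energy_def sum_divide_distrib)
qed

text \<open>
  The quotient is invariant under affine changes of \<open>f\<close>, so a minimizing sequence can be normalized
  to have minimum 0 and maximum 1 on the vertices. A pointwise limit of a subsequence is again
  nonconstant. Near-minimality is kept in the form of an inequality for each fixed centre \<open>c\<close>,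
  because such inequalities between finite sums pass to the limit term by term.
\<close>
lemma gamma1_attained:
  assumes fin: "finite (verts G)" and card: "2 \<le> card (verts G)" and p: "p > 0"
    and wf: "wf_digraph G"
  obtains f where "nonconst_on (verts G) f"
    and "edge_energy p G f = gamma1 p G * deviation p (verts G) f"
proof -
  let ?V = "verts G"
  interpret wf_digraph G by (rule wf)
  define t where "t k = gamma1 p G + inverse (real (Suc k))" for k
  have "\<exists>h. (\<forall>v\<in>?V. \<bar>h v\<bar> \<le> 1) \<and> (\<exists>u\<in>?V. \<exists>v\<in>?V. h u = 0 \<and> h v = 1) \<and>
          (\<forall>c. edge_energy p G h \<le> t k * (\<Sum>v\<in>?V. \<bar>h v - c\<bar> powr p))" for k
  proof -
    obtain f0 where f0: "nonconst_on ?V f0"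
      using ex_nonconst_on[OF card] .
    have "Inf {edge_energy p G f / deviation p ?V f |f. nonconst_on ?V f} < t k"
      by (simp add: t_def flip: gamma1_eq_Inf_quotients)
    then have "\<exists>x\<in>{edge_energy p G f / deviation p ?V f |f. nonconst_on ?V f}. x < t k"
      using f0 by (intro cInf_lessD) blast+
    then obtain f where f: "nonconst_on ?V f" "edge_energy p G f / deviation p ?V f < t k"
      by blast
    have dev: "0 < deviation p ?V f"
      using deviation_pos[OF fin f(1) p] .
    have en: "edge_energy p G f \<le> t k * deviation p ?V f"
      using f(2) dev by (simp add: field_simps)
    have t: "0 \<le> t k"
      using en edge_energy_nonneg[of p G f] dev by (smt (verit) mult_neg_pos)
    have im: "finite (f ` ?V)" "f ` ?V \<noteq> {}"
      using fin card by auto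
    obtain u where u: "u \<in> ?V" "\<And>v. v \<in> ?V \<Longrightarrow> f u \<le> f v"
      using Min_in[OF im] Min_le[OF im(1)] by fastforce
    obtain w where w: "w \<in> ?V" "\<And>v. v \<in> ?V \<Longrightarrow> f v \<le> f w"
      using Max_in[OF im] Max_ge[OF im(1)] by fastforce
    define s where "s = f w - f u"
    have s: "s > 0"
      using f(1) u w unfolding nonconst_on_def s_def by (smt (verit))
    define h where "h = (\<lambda>v. (f v - f u) / s)"
    have "edge_energy p G h \<le> t k * (\<Sum>v\<in>?V. \<bar>h v - c\<bar> powr p)" for c
    proof -
      have "h v - c = (f v - (f u + c * s)) / s" for v
        using s by (simp add: h_def field_simps)
      then have "(\<Sum>v\<in>?V. \<bar>h v - c\<bar> powr p) = (\<Sum>v\<in>?V. \<bar>f v - (f u + c * s)\<bar> powr p) / s powr p"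
        using s by (simp add: powr_divide sum_divide_distrib)
      moreover have "edge_energy p G f \<le> t k * (\<Sum>v\<in>?V. \<bar>f v - (f u + c * s)\<bar> powr p)"
        using en mult_left_mono[OF deviation_le t, of p ?V f "f u + c * s"] by linarith
      ultimately show ?thesis
        unfolding h_def edge_energy_affine[OF s] using s by (simp add: divide_right_mono)
    qed
    moreover have "\<bar>h v\<bar> \<le> 1" if "v \<in> ?V" for v
      using u(2)[OF that] w(2)[OF that] s by (simp add: h_def s_def field_simps)
    moreover have "h u = 0" "h w = 1"
      using s by (auto simp: h_def s_def)
    ultimately show ?thesis
      using u(1) w(1) by blast
  qed
  then obtain h where h: "\<And>k v. v \<in> ?V \<Longrightarrow> \<bar>h k v\<bar> \<le> 1"
      "\<And>k. \<exists>u\<in>?V. \<exists>v\<in>?V. h k u = 0 \<and> h k v = 1"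
      "\<And>k c. edge_energy p G (h k) \<le> t k * (\<Sum>v\<in>?V. \<bar>h k v - c\<bar> powr p)"
    by metis
  obtain s l where s: "strict_mono (s :: nat \<Rightarrow> nat)"
    and l: "\<And>v. v \<in> ?V \<Longrightarrow> (\<lambda>k. h (s k) v) \<longlonglongrightarrow> l v"
    using bounded_functions_subseq_pointwise[OF fin, of h 1] h(1) by blast
  \<comment> \<open>If the limit were constant, all values would eventually be within \<open>1/2\<close> of it, although
     the values 0 and 1 both occur.\<close>
  have nonconst: "nonconst_on ?V l"
  proof (rule ccontr)
    assume "\<not> nonconst_on ?V l"
    then obtain c where c: "\<forall>v\<in>?V. l v = c"
      unfolding not_const_iff_nonconst_on[symmetric] by blast
    have "\<forall>\<^sub>F k in sequentially. \<forall>v\<in>?V. dist (h (s k) v) c < 1/2"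
      using fin tendstoD[OF l, of _ "1/2"] c by (intro eventually_ball_finite) auto
    then obtain k where k: "\<forall>v\<in>?V. dist (h (s k) v) c < 1/2"
      using eventually_happens' sequentially_bot by blast
    obtain u v where "u \<in> ?V" "v \<in> ?V" "h (s k) u = 0" "h (s k) v = 1"
      using h(2) by blast
    with k show False
      by (smt (verit) dist_real_def field_sum_of_halves)
  qed
  have powr_lim: "(\<lambda>k. \<bar>a k\<bar> powr p) \<longlonglongrightarrow> \<bar>b\<bar> powr p" if "a \<longlonglongrightarrow> b" for a b
    using that p by (intro tendsto_powr' tendsto_rabs tendsto_const) auto
  have "edge_energy p G l \<le> gamma1 p G * (\<Sum>v\<in>?V. \<bar>l v - c\<bar> powr p)" for c
  proof (rule LIMSEQ_le)
    show "(\<lambda>k. edge_energy p G (h (s k))) \<longlonglongrightarrow> edge_energy p G l"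
      unfolding edge_energy_def by (intro tendsto_sum powr_lim tendsto_diff l) auto
    have "t \<longlonglongrightarrow> gamma1 p G + 0"
      unfolding t_def by (intro tendsto_add tendsto_const LIMSEQ_inverse_real_of_nat)
    then have "(\<lambda>k. t (s k)) \<longlonglongrightarrow> gamma1 p G"
      using LIMSEQ_subseq_LIMSEQ[OF _ s] by (fastforce simp: o_def)
    then show "(\<lambda>k. t (s k) * (\<Sum>v\<in>?V. \<bar>h (s k) v - c\<bar> powr p))
        \<longlonglongrightarrow> gamma1 p G * (\<Sum>v\<in>?V. \<bar>l v - c\<bar> powr p)"
      by (intro tendsto_mult tendsto_sum powr_lim tendsto_diff l tendsto_const) auto
    show "\<exists>N. \<forall>k\<ge>N. edge_energy p G (h (s k)) \<le> t (s k) * (\<Sum>v\<in>?V. \<bar>h (s k) v - c\<bar> powr p)"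
      using h(3) by blast
  qed
  moreover have "0 \<le> gamma1 p G"
    by (rule gamma1_greatest[OF fin card p]) (simp add: edge_energy_nonneg)
  ultimately have "edge_energy p G l \<le> gamma1 p G * deviation p ?V l"
  proof (cases "gamma1 p G = 0")
    case False
    assume *: "\<And>c. edge_energy p G l \<le> gamma1 p G * (\<Sum>v\<in>?V. \<bar>l v - c\<bar> powr p)"
      and "0 \<le> gamma1 p G"
    then have "edge_energy p G l / gamma1 p G \<le> deviation p ?V l"
      using False by (intro deviation_greatest) (simp add: field_simps)
    then show ?thesis
      using False \<open>0 \<le> gamma1 p G\<close> by (simp add: field_simps)
  qed simp
  then show ?thesis
    using that[OF nonconst] gamma1_mult_deviation_le[OF fin p nonconst] by simp
qed

lemma edge_energy_replace_edges_parallel: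
  "edge_energy p (replace_edges_parallel k G) f = real k * edge_energy p G f"
proof -
  have "edge_energy p (replace_edges_parallel k G) f =
      (\<Sum>e\<in>arcs G. \<Sum>j\<in>{1..k}. \<bar>f (tail G e) - f (head G e)\<bar> powr p)"
    unfolding edge_energy_def replace_edges_parallel_def
    by (subst sum.cartesian_product) (simp add: split_def)
  then show ?thesis
    by (simp add: edge_energy_def sum_distrib_left)
qed

lemma gamma1_replace_edges_parallel:
  assumes fin: "finite (verts G)" and card: "2 \<le> card (verts G)" and p: "p > 0"
    and wf: "wf_digraph G"
  shows "gamma1 p (replace_edges_parallel k G) = real k * gamma1 p G"
proof (rule antisym)
  let ?H = "replace_edges_parallel k G"
  have V: "verts ?H = verts G"
    by (simp add: replace_edges_parallel_def)
  obtain f where f: "nonconst_on (verts G) f"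
      "edge_energy p G f = gamma1 p G * deviation p (verts G) f"
    using gamma1_attained[OF assms] .
  have "gamma1 p ?H * deviation p (verts G) f \<le> real k * gamma1 p G * deviation p (verts G) f"
    using gamma1_mult_deviation_le[of ?H p f] fin p f
    by (simp add: V edge_energy_replace_edges_parallel)
  then show "gamma1 p ?H \<le> real k * gamma1 p G"
    using deviation_pos[OF fin f(1) p] by simp
  show "real k * gamma1 p G \<le> gamma1 p ?H"
  proof (rule gamma1_greatest)
    fix f assume "nonconst_on (verts ?H) f"
    then have "gamma1 p G * deviation p (verts G) f \<le> edge_energy p G f"
      using gamma1_mult_deviation_le[OF fin p] by (simp add: V)
    then show "real k * gamma1 p G * deviation p (verts ?H) f \<le> edge_energy p ?H f"
      by (simp add: V edge_energy_replace_edges_parallel mult_left_mono mult.assoc)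
  qed (use fin card p V in auto)
qed

text \<open>
  Pulling a test function back along the isomorphism preserves its energy, orientations being
  irrelevant by the absolute value, and its deviation. For pumpkin chains the reverse inequality
  comes from the comparison with the path, so this direction is enough.
\<close>
lemma gamma1_le_of_multigraph_iso:
  assumes iso: "multigraph_iso G H" and fin: "finite (verts G)" and card: "2 \<le> card (verts G)"
    and p: "p > 0"
  shows "gamma1 p G \<le> gamma1 p H"
proof -
  obtain \<phi> \<psi> where \<phi>: "bij_betw \<phi> (verts G) (verts H)" and \<psi>: "bij_betw \<psi> (arcs G) (arcs H)"
    and ends: "\<And>e. e \<in> arcs G \<Longrightarrow> {\<phi> (tail G e), \<phi> (head G e)} = {tail H (\<psi> e), head H (\<psi> e)}"
    using iso unfolding multigraph_iso_def by blast
  have finH: "finite (verts H)" and cardH: "2 \<le> card (verts H)"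
    using bij_betw_finite[OF \<phi>] bij_betw_same_card[OF \<phi>] fin card by auto
  show ?thesis
  proof (rule gamma1_greatest[OF finH cardH p])
    fix f assume f: "nonconst_on (verts H) f"
    have "edge_energy p G (\<lambda>v. f (\<phi> v)) = (\<Sum>e\<in>arcs G. \<bar>f (tail H (\<psi> e)) - f (head H (\<psi> e))\<bar> powr p)"
      unfolding edge_energy_def
    proof (rule sum.cong)
      fix e assume "e \<in> arcs G"
      from ends[OF this] show "\<bar>f (\<phi> (tail G e)) - f (\<phi> (head G e))\<bar> powr p =
          \<bar>f (tail H (\<psi> e)) - f (head H (\<psi> e))\<bar> powr p"
        by (auto simp: doubleton_eq_iff abs_minus_commute)
    qed simp
    also have "\<dots> = edge_energy p H f"
      unfolding edge_energy_def
      by (rule sum.reindex_bij_betw[OF \<psi>, of "\<lambda>e. \<bar>f (tail H e) - f (head H e)\<bar> powr p"])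
    finally have "edge_energy p G (\<lambda>v. f (\<phi> v)) = edge_energy p H f" .
    then show "gamma1 p G * deviation p (verts H) f \<le> edge_energy p H f"
      using gamma1_mult_deviation_le[OF fin p, of "\<lambda>v. f (\<phi> v)"] f
        nonconst_on_reindex[OF \<phi>, of "\<lambda>v. f (\<phi> v)" f]
        deviation_reindex[OF \<phi>, of "\<lambda>v. f (\<phi> v)" f]
      by simp
  qed
qed

section \<open>Minimizers on the path graph\<close>

lemma wf_digraph_path_graph: "wf_digraph (path_graph n)"
  by unfold_locales (auto simp: path_graph_def)

lemma verts_path_graph [simp]: "verts (path_graph n) = {1..n}"
  by (simp add: path_graph_def)

lemma edge_energy_path_graph:
  "edge_energy p (path_graph n) g = (\<Sum>k\<in>{1..<n}. \<bar>g (Suc k) - g k\<bar> powr p)"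
  by (simp add: edge_energy_def path_graph_def abs_minus_commute)

text \<open>
  The negative terms of a nondecreasing sequence come first. If a proper initial sum were
  nonnegative, then \<open>a k \<ge> 0\<close>, so the remaining terms are nonnegative with a nonpositive sum and all
  vanish; then the last and largest term is 0, and the whole sequence is 0.
\<close>
lemma partial_sum_neg_of_mono_sum_zero:
  fixes a :: "nat \<Rightarrow> real"
  assumes mono: "mono_on {1..n} a" and zero: "(\<Sum>i\<in>{1..n}. a i) = 0"
    and k: "1 \<le> k" "k < n" and nz: "\<exists>i\<in>{1..n}. a i \<noteq> 0"
  shows "(\<Sum>i\<in>{1..k}. a i) < 0"
proof (rule ccontr)
  assume "\<not> ?thesis"
  then have low: "0 \<le> (\<Sum>i\<in>{1..k}. a i)" by simp
  have le: "a i \<le> a j" if "1 \<le> i" "i \<le> j" "j \<le> n" for i j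
    using mono that by (auto simp: mono_on_def)
  have "(\<Sum>i\<in>{1..k}. a i) \<le> (\<Sum>i\<in>{1..k}. a k)"
    using k by (intro sum_mono le) auto
  with low have "0 \<le> real k * a k"
    by simp
  then have ak: "0 \<le> a k"
    using k by (simp add: zero_le_mult_iff)
  have "{1..n} = {1..k} \<union> {k<..n}"
    using k by auto
  then have "(\<Sum>i\<in>{1..k}. a i) + (\<Sum>i\<in>{k<..n}. a i) = 0"
    using zero sum.union_disjoint[of "{1..k}" "{k<..n}" a] by (simp add: ivl_disj_int)
  moreover have up: "0 \<le> a i" if "i \<in> {k<..n}" for i
    using ak le[of k i] k that by auto
  moreover have "0 \<le> (\<Sum>i\<in>{k<..n}. a i)"
    by (rule sum_nonneg) (rule up)
  ultimately have "(\<Sum>i\<in>{k<..n}. a i) = 0"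
    using low by linarith
  then have "a n = 0"
    using up k by (subst (asm) sum_nonneg_eq_0_iff) auto
  then have "a i \<le> 0" if "i \<in> {1..n}" for i
    using le[of i n] that by auto
  then have "\<forall>i\<in>{1..n}. a i = 0"
    using sum_nonneg_eq_0_iff[of "{1..n}" "\<lambda>i. - a i"] zero by (simp add: sum_negf)
  with nz show False by blast
qed

text \<open>
  At such a centre \<open>c\<close> the derivative of \<open>\<lambda>c. \<Sum>i. \<bar>g i - c\<bar> powr p\<close> vanishes, for
  \<open>q = p - 1\<close>. The sum is nonnegative for \<open>c = g 1\<close> and nonpositive for \<open>c = g n\<close>.
\<close>
lemma ex_balanced_centre:
  fixes g :: "nat \<Rightarrow> real"
  assumes mono: "mono_on {1..n} g" and n: "1 \<le> n" and q: "q > 0"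
  shows "\<exists>c. (\<Sum>i\<in>{1..n}. signed_powr q (g i - c)) = 0"
proof -
  let ?F = "\<lambda>c. \<Sum>i\<in>{1..n}. signed_powr q (g i - c)"
  have le: "g i \<le> g j" if "1 \<le> i" "i \<le> j" "j \<le> n" for i j
    using mono that by (auto simp: mono_on_def)
  have nonneg: "0 \<le> signed_powr q x" if "0 \<le> x" for x
    using that by (auto simp: signed_powr_def sgn_if)
  have nonpos: "signed_powr q x \<le> 0" if "x \<le> 0" for x
    using that by (auto simp: signed_powr_def sgn_if)
  have "continuous_on UNIV ?F"
    by (intro continuous_on_sum
        continuous_on_compose2[OF continuous_on_signed_powr[OF q]] continuous_intros) auto
  then have "continuous_on {g 1..g n} ?F"
    by (rule continuous_on_subset) auto
  moreover have "0 \<le> ?F (g 1)"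
    by (intro sum_nonneg nonneg) (use le in auto)
  moreover have "?F (g n) \<le> 0"
    by (intro sum_nonpos nonpos) (use le in auto)
  ultimately show ?thesis
    using IVT2'[of ?F "g n" 0 "g 1"] le[of 1 n] n by blast
qed

text \<open>
  Suppose the gap at \<open>k\<close> is zero and lower the first \<open>k\<close> values by \<open>t\<close>. The energy grows by
  \<open>t powr p\<close>. By the tangent inequality at the balanced centre, the deviation grows by at least
  \<open>p * t * m\<close>, where \<open>- m\<close> is the sum of the first \<open>k\<close> of the slopes \<open>signed_powr (p - 1) (g i - c0)\<close>,
  which is negative. Hence \<open>\<gamma> * p * m \<le> t powr (p - 1)\<close> for all \<open>t > 0\<close>, which fails for
  small \<open>t\<close>.
\<close>
lemma path_minimizer_strictly_increasing:
  assumes p: "p > 1" and mono: "mono_on {1..n} g" and nonconst: "nonconst_on {1..n} g"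
    and min: "edge_energy p (path_graph n) g = gamma1 p (path_graph n) * deviation p {1..n} g"
    and k: "k \<in> {1..<n}"
  shows "g k < g (Suc k)"
proof (rule ccontr)
  assume "\<not> ?thesis"
  moreover have le: "g i \<le> g j" if "1 \<le> i" "i \<le> j" "j \<le> n" for i j
    using mono that by (auto simp: mono_on_def)
  ultimately have flat: "g (Suc k) = g k"
    using k by (intro antisym) auto
  define \<gamma> where "\<gamma> = gamma1 p (path_graph n)"
  have dev: "0 < deviation p {1..n} g"
    using deviation_pos[OF _ nonconst] p by simp
  have ends: "g 1 < g n"
  proof -
    obtain u v where "u \<in> {1..n}" "v \<in> {1..n}" "g u \<noteq> g v"
      using nonconst unfolding nonconst_on_def by blast
    then show ?thesis
      using le[of 1 u] le[of u n] le[of 1 v] le[of v n] by fastforce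
  qed
  have "0 < edge_energy p (path_graph n) g"
  proof (rule ccontr)
    assume "\<not> ?thesis"
    then have "edge_energy p (path_graph n) g = 0"
      using edge_energy_nonneg[of p "path_graph n" g] by simp
    then have "\<forall>j\<in>{1..<n}. g (Suc j) - g j = 0"
      unfolding edge_energy_path_graph by (subst (asm) sum_nonneg_eq_0_iff) auto
    then have "(\<Sum>j\<in>{1..<n}. g (Suc j) - g j) = 0"
      by simp
    moreover have "(\<Sum>j\<in>{1..<n}. g (Suc j) - g j) = g n - g 1"
      using k by (intro sum_Suc_diff') auto
    ultimately show False
      using ends by simp
  qed
  then have \<gamma>: "0 < \<gamma>"
    using min dev by (simp add: \<gamma>_def zero_less_mult_iff)
  obtain c0 where c0: "(\<Sum>i\<in>{1..n}. signed_powr (p - 1) (g i - c0)) = 0"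
    using ex_balanced_centre[OF mono, of "p - 1"] k p by auto
  define a where "a i = signed_powr (p - 1) (g i - c0)" for i
  define m where "m = - (\<Sum>i\<in>{1..k}. a i)"
  have "mono_on {1..n} a"
    unfolding a_def using le p by (intro mono_onI signed_powr_mono) auto
  moreover have "\<exists>i\<in>{1..n}. a i \<noteq> 0"
  proof (rule ccontr)
    assume "\<not> ?thesis"
    then have "g 1 - c0 = 0" "g n - c0 = 0"
      using k unfolding a_def by auto
    then show False using ends by simp
  qed
  ultimately have m: "0 < m"
    using partial_sum_neg_of_mono_sum_zero[of n a k] c0 k by (auto simp: m_def a_def)
  have *: "\<gamma> * (p * t * m) \<le> t powr p" if t: "t > 0" for t
  proof -
    define h where "h i = (if i \<le> k then g i - t else g i)" for i
    have "deviation p {1..n} g + p * t * m \<le> deviation p {1..n} h"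
    proof (rule deviation_greatest)
      fix c
      \<comment> \<open>Since the slopes sum to zero, moving the centre from \<open>c0\<close> to \<open>c\<close> does not change the linear
         term: the bound holds for all centres at once.\<close>
      have "(\<Sum>i\<in>{1..n}. a i * (h i - c - (g i - c0))) =
          (\<Sum>i\<in>{1..n}. (c0 - c) * a i - t * (if i \<le> k then a i else 0))"
        by (rule sum.cong) (auto simp: h_def algebra_simps)
      also have "\<dots> = (c0 - c) * (\<Sum>i\<in>{1..n}. a i) - t * (\<Sum>i\<in>{1..n}. if i \<le> k then a i else 0)"
        by (simp add: sum_subtractf sum_distrib_left)
      also have "(\<Sum>i\<in>{1..n}. if i \<le> k then a i else 0) = (\<Sum>i\<in>{1..k}. a i)"
        using k by (intro sum.mono_neutral_cong_right) auto
      finally have lin: "(\<Sum>i\<in>{1..n}. a i * (h i - c - (g i - c0))) = t * m"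
        using c0 by (simp add: a_def m_def)
      have "deviation p {1..n} g + p * t * m \<le>
          (\<Sum>i\<in>{1..n}. \<bar>g i - c0\<bar> powr p) + p * (\<Sum>i\<in>{1..n}. a i * (h i - c - (g i - c0)))"
        unfolding lin using deviation_le[of p "{1..n}" g c0] by simp
      also have "\<dots> = (\<Sum>i\<in>{1..n}. \<bar>g i - c0\<bar> powr p + p * a i * (h i - c - (g i - c0)))"
        by (simp add: sum.distrib sum_distrib_left mult.assoc)
      also have "\<dots> \<le> (\<Sum>i\<in>{1..n}. \<bar>h i - c\<bar> powr p)"
        unfolding a_def by (intro sum_mono abs_powr_tangent p)
      finally show "deviation p {1..n} g + p * t * m \<le> (\<Sum>i\<in>{1..n}. \<bar>h i - c\<bar> powr p)" .
    qed
    then have "\<gamma> * (deviation p {1..n} g + p * t * m) \<le> \<gamma> * deviation p {1..n} h"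
      using \<gamma> by (intro mult_left_mono) auto
    moreover have "nonconst_on {1..n} h"
    proof -
      have "h 1 < h n"
        using ends t k by (auto simp: h_def)
      then show ?thesis
        unfolding nonconst_on_def using k by (intro bexI[of _ 1] bexI[of _ n]) auto
    qed
    then have "\<gamma> * deviation p {1..n} h \<le> edge_energy p (path_graph n) h"
      using gamma1_mult_deviation_le[of "path_graph n" p h] p by (simp add: \<gamma>_def)
    moreover have "edge_energy p (path_graph n) h = edge_energy p (path_graph n) g + t powr p"
    proof -
      have "edge_energy p (path_graph n) h =
          (\<Sum>j\<in>{1..<n}. \<bar>g (Suc j) - g j\<bar> powr p + (if j = k then t powr p else 0))"
        unfolding edge_energy_path_graph using flat t p by (intro sum.cong) (auto simp: h_def)
      also have "\<dots> = edge_energy p (path_graph n) g + t powr p"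
        using k by (simp add: edge_energy_path_graph sum.distrib)
      finally show ?thesis .
    qed
    ultimately show ?thesis
      using min by (simp add: \<gamma>_def algebra_simps)
  qed
  \<comment> \<open>Choose \<open>t\<close> such that \<open>t powr (p - 1)\<close> is half of \<open>\<gamma> * p * m\<close>.\<close>
  define b where "b = \<gamma> * p * m / 2"
  have b: "0 < b"
    using \<gamma> p m by (simp add: b_def)
  define t where "t = b powr (1 / (p - 1))"
  have t: "0 < t"
    using b by (simp add: t_def)
  have "t powr p = t * t powr (p - 1)"
    using powr_mult_base[of t "p - 1"] t by simp
  also have "t powr (p - 1) = b"
    using b p by (simp add: t_def powr_powr)
  finally have "\<gamma> * (p * t * m) \<le> t * b"
    using *[OF t] by simp
  moreover have "\<gamma> * (p * t * m) = 2 * (t * b)"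
    by (simp add: b_def)
  moreover have "0 < t * b"
    using t b by simp
  ultimately show False by linarith
qed

section \<open>Edge cuts\<close>

lemma not_connected_del_crossing_arcs:
  assumes "S \<subseteq> verts G" "S \<noteq> {}" "S \<noteq> verts G"
  shows "\<not> Digraph_Component.connected
    (del_arcs G {e \<in> arcs G. (tail G e \<in> S) \<noteq> (head G e \<in> S)})"
    (is "\<not> Digraph_Component.connected ?H")
proof
  assume con: "Digraph_Component.connected ?H"
  obtain u v where uv: "u \<in> S" "v \<in> verts G" "v \<notin> S"
    using assms by blast
  have V: "verts ?H = verts G"
    by (simp add: del_arcs_def)
  have "u \<in> verts ?H" "v \<in> verts ?H"
    using uv assms(1) V by auto
  then have "(u, v) \<in> rtrancl_on (verts G) (parcs (mk_symmetric ?H))"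
    using con V
    unfolding Digraph_Component.connected_def strongly_connected_def reachable_def
    by (simp only: with_proj_simps pverts_mk_symmetric)
  then have "v \<in> S"
  proof (induction rule: rtrancl_on_induct)
    case (step y z)
    then show ?case
      by (auto simp: parcs_mk_symmetric del_arcs_def)
  qed (use uv in simp)
  with uv show False by blast
qed

lemma edge_connectivity_le_cut:
  assumes "S \<subseteq> verts G" "S \<noteq> {}" "S \<noteq> verts G"
  shows "edge_connectivity G \<le> card {e \<in> arcs G. (tail G e \<in> S) \<noteq> (head G e \<in> S)}"
  unfolding edge_connectivity_def
  by (rule cInf_lower) (use not_connected_del_crossing_arcs[OF assms] in auto)

text \<open>
  A set of arcs realizing the edge connectivity exists because the arcs at a single vertex form a
  disconnecting set, and it is nonempty because \<open>G\<close> itself is connected.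
\<close>
lemma edge_connectivity_pos:
  assumes fin: "finite (arcs G)" and card: "2 \<le> card (verts G)"
    and con: "Digraph_Component.connected G"
  shows "1 \<le> edge_connectivity G"
proof -
  obtain u where u: "u \<in> verts G"
    using card by fastforce
  have "{u} \<noteq> verts G"
    using card by (metis card_1_singleton_iff One_nat_def not_less_eq_eq numeral_2_eq_2 order_refl)
  then have "{card F |F. F \<subseteq> arcs G \<and> \<not> Digraph_Component.connected (del_arcs G F)} \<noteq> {}"
    using not_connected_del_crossing_arcs[of "{u}" G] u by auto
  then have "edge_connectivity G \<in>
      {card F |F. F \<subseteq> arcs G \<and> \<not> Digraph_Component.connected (del_arcs G F)}"
    unfolding edge_connectivity_def by (rule Inf_nat_def1)
  then obtain F where F: "edge_connectivity G = card F" "F \<subseteq> arcs G"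
      "\<not> Digraph_Component.connected (del_arcs G F)"
    by blast
  have "del_arcs G {} = G"
    by (cases G) (simp add: del_arcs_def)
  then have "F \<noteq> {}"
    using F(3) con by metis
  then show ?thesis
    using F fin finite_subset[of F] by (simp add: Suc_le_eq card_gt_0_iff)
qed

section \<open>Comparison with the path by sorting the vertices\<close>

text \<open>
  The sorted list of vertices, with \<open>r\<close> the position of a vertex in it and \<open>g\<close> the list of values.
  Positions count from 1 as in \<^const>\<open>path_graph\<close>, list indices from 0; this is the origin of \<open>i - 1\<close>
  in the proof.
\<close>
lemma ex_monotone_ranking:
  fixes f :: "'a \<Rightarrow> real"
  assumes "finite S"
  obtains r g where "bij_betw r S {1..card S}" "mono_on {1..card S} g"
    "\<And>v. v \<in> S \<Longrightarrow> f v = g (r v)"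
proof -
  obtain ys where ys: "set ys = S" "distinct ys"
    using finite_distinct_list[OF assms] by blast
  define xs where "xs = sort_key f ys"
  have xs: "set xs = S" "distinct xs" "sorted (map f xs)"
    using ys by (simp_all add: xs_def)
  have len: "length xs = card S"
    using xs distinct_card by fastforce
  have bij: "bij_betw (\<lambda>i. xs ! (i - 1)) {1..card S} S"
  proof -
    have "bij_betw ((!) xs) {..<card S} S"
      using bij_betw_nth[OF xs(2)] xs(1) len by simp
    moreover have "bij_betw (\<lambda>i. i - 1) {1..card S} {..<card S}"
      by (rule bij_betwI[where g = Suc]) auto
    ultimately show ?thesis
      using bij_betw_trans by (fastforce simp: o_def)
  qed
  show ?thesis
  proof
    show "bij_betw (inv_into {1..card S} (\<lambda>i. xs ! (i - 1))) S {1..card S}"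
      using bij by (rule bij_betw_inv_into)
    show "mono_on {1..card S} (\<lambda>i. f (xs ! (i - 1)))"
    proof (rule mono_onI)
      fix i j assume "i \<in> {1..card S}" "j \<in> {1..card S}" "i \<le> j"
      then show "f (xs ! (i - 1)) \<le> f (xs ! (j - 1))"
        using sorted_nth_mono[OF xs(3), of "i - 1" "j - 1"] len by auto
    qed
    show "f v = f (xs ! (inv_into {1..card S} (\<lambda>i. xs ! (i - 1)) v - 1))" if "v \<in> S" for v
      using bij_betw_inv_into_right[OF bij that] by simp
  qed
qed

text \<open>
  Numbering each fibre of \<open>\<kappa>\<close> by \<open>1, \<dots>, c\<close> identifies \<open>A\<close> with a product. This supplies the edge
  bijection onto a pumpkin chain, whose arcs are pairs of a path edge and a copy number.
\<close>
lemma ex_bij_betw_Times_of_equal_fibres: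
  fixes \<kappa> :: "'a \<Rightarrow> 'k" and c :: nat
  assumes fin: "finite A" and \<kappa>: "\<And>e. e \<in> A \<Longrightarrow> \<kappa> e \<in> K"
    and card: "\<And>k. k \<in> K \<Longrightarrow> card {e \<in> A. \<kappa> e = k} = c"
  shows "\<exists>\<beta>. bij_betw (\<lambda>e. (\<kappa> e, \<beta> e)) A (K \<times> {1..c})"
proof -
  have "\<exists>b. bij_betw b {e \<in> A. \<kappa> e = k} {1..c}" if "k \<in> K" for k
    using card[OF that] fin by (intro finite_same_card_bij) auto
  then obtain b where b: "\<And>k. k \<in> K \<Longrightarrow> bij_betw (b k) {e \<in> A. \<kappa> e = k} {1..c}"
    by metis
  have "bij_betw (\<lambda>e. (\<kappa> e, b (\<kappa> e) e)) A (K \<times> {1..c})"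
  proof (rule bij_betw_imageI)
    show "inj_on (\<lambda>e. (\<kappa> e, b (\<kappa> e) e)) A"
    proof (rule inj_onI)
      fix e e' assume e: "e \<in> A" "e' \<in> A" "(\<kappa> e, b (\<kappa> e) e) = (\<kappa> e', b (\<kappa> e') e')"
      then have "b (\<kappa> e) e = b (\<kappa> e) e'" "e \<in> {x \<in> A. \<kappa> x = \<kappa> e}" "e' \<in> {x \<in> A. \<kappa> x = \<kappa> e}"
        by auto
      then show "e = e'"
        by (rule inj_onD[OF bij_betw_imp_inj_on[OF b[OF \<kappa>[OF e(1)]]]])
    qed
    show "(\<lambda>e. (\<kappa> e, b (\<kappa> e) e)) ` A = K \<times> {1..c}"
    proof (intro equalityI subsetI)
      fix x assume "x \<in> (\<lambda>e. (\<kappa> e, b (\<kappa> e) e)) ` A"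
      then obtain e where e: "e \<in> A" "x = (\<kappa> e, b (\<kappa> e) e)" by blast
      then have "b (\<kappa> e) e \<in> {1..c}"
        using bij_betw_apply[OF b[OF \<kappa>[OF e(1)]], of e] by blast
      then show "x \<in> K \<times> {1..c}"
        using e \<kappa> by blast
    next
      fix x assume "x \<in> K \<times> {1..c}"
      then obtain k j where x: "x = (k, j)" "k \<in> K" "j \<in> {1..c}" by blast
      then have "j \<in> b k ` {e \<in> A. \<kappa> e = k}"
        using bij_betw_imp_surj_on[OF b[OF x(2)]] by blast
      then show "x \<in> (\<lambda>e. (\<kappa> e, b (\<kappa> e) e)) ` A"
        using x(1) by blast
    qed
  qed
  then show ?thesis
    by (rule exI[where x = "\<lambda>e. b (\<kappa> e) e"])
qed

text \<open>
  Gap \<open>k\<close> lies between the ranks \<open>k\<close> and \<open>Suc k\<close>; it stands for the edge \<open>k\<close> of the path graph and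
  for the cut separating the vertices of rank at most \<open>k\<close> from the others.
\<close>
definition crossed_gaps :: "('a \<Rightarrow> nat) \<Rightarrow> ('a, 'b) pre_digraph \<Rightarrow> 'b \<Rightarrow> nat set" where
  "crossed_gaps r G e =
     {min (r (tail G e)) (r (head G e)) ..< max (r (tail G e)) (r (head G e))}"

context
  fixes G :: "('a, 'b) pre_digraph" and r :: "'a \<Rightarrow> nat" and n :: nat
  assumes graph: "combinatorial_graph G" and card: "card (verts G) = n"
    and r: "bij_betw r (verts G) {1..n}"
begin

interpretation combinatorial_graph G by (rule graph)

lemma crossed_gaps_subset:
  assumes e: "e \<in> arcs G"
  shows "crossed_gaps r G e \<subseteq> {1..<n}"
proof -
  have "r (tail G e) \<in> {1..n}" "r (head G e) \<in> {1..n}"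
    using bij_betwE[OF r] e by auto
  then show ?thesis
    by (auto simp: crossed_gaps_def)
qed

lemma edge_connectivity_le_crossings:
  assumes k: "k \<in> {1..<n}"
  shows "edge_connectivity G \<le> card {e \<in> arcs G. k \<in> crossed_gaps r G e}"
proof -
  define S where "S = {v \<in> verts G. r v \<le> k}"
  have "1 \<in> r ` verts G" "n \<in> r ` verts G"
    using r k by (auto simp: bij_betw_def)
  then obtain u w where "u \<in> verts G" "r u = 1" "w \<in> verts G" "r w = n"
    by fastforce
  then have "u \<in> S" "w \<in> verts G - S"
    using k by (auto simp: S_def)
  then have "edge_connectivity G \<le> card {e \<in> arcs G. (tail G e \<in> S) \<noteq> (head G e \<in> S)}"
    by (intro edge_connectivity_le_cut) (auto simp: S_def)
  also have "{e \<in> arcs G. (tail G e \<in> S) \<noteq> (head G e \<in> S)} = {e \<in> arcs G. k \<in> crossed_gaps r G e}"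
    using tail_in_verts head_in_verts by (auto simp: S_def crossed_gaps_def)
  finally show ?thesis .
qed

context
  fixes f :: "'a \<Rightarrow> real" and g :: "nat \<Rightarrow> real" and p :: real
  assumes mono: "mono_on {1..n} g" and f: "\<And>v. v \<in> verts G \<Longrightarrow> f v = g (r v)" and p: "p > 1"
begin

private abbreviation (input) gap :: "nat \<Rightarrow> real" where
  "gap k \<equiv> g (Suc k) - g k"

lemma gap_nonneg: "k \<in> {1..<n} \<Longrightarrow> 0 \<le> gap k"
  using mono by (auto simp: mono_on_def)

lemma difference_eq_sum_gaps:
  assumes e: "e \<in> arcs G"
  shows "\<bar>f (tail G e) - f (head G e)\<bar> = (\<Sum>k\<in>crossed_gaps r G e. gap k)"
proof -
  let ?i = "r (tail G e)" and ?j = "r (head G e)"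
  have ij: "?i \<in> {1..n}" "?j \<in> {1..n}"
    using bij_betwE[OF r] e by auto
  have "(\<Sum>k\<in>crossed_gaps r G e. gap k) = g (max ?i ?j) - g (min ?i ?j)"
    unfolding crossed_gaps_def by (rule sum_Suc_diff') simp
  also have "\<dots> = \<bar>g ?i - g ?j\<bar>"
    using mono ij by (auto simp: mono_on_def max_def min_def)
  finally show ?thesis
    using f e by simp
qed

text \<open>
  Double counting of the incidences between edges and the gaps that they cross.
\<close>
lemma sum_gaps_eq_sum_crossings:
  "(\<Sum>e\<in>arcs G. \<Sum>k\<in>crossed_gaps r G e. gap k powr p) =
   (\<Sum>k\<in>{1..<n}. real (card {e \<in> arcs G. k \<in> crossed_gaps r G e}) * gap k powr p)"
proof -
  have "(\<Sum>e\<in>arcs G. \<Sum>k\<in>crossed_gaps r G e. gap k powr p) =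
      (\<Sum>e\<in>arcs G. \<Sum>k | k \<in> {1..<n} \<and> k \<in> crossed_gaps r G e. gap k powr p)"
    using crossed_gaps_subset by (intro sum.cong arg_cong2[of _ _ _ _ sum] refl) blast
  also have "\<dots> = (\<Sum>k\<in>{1..<n}. \<Sum>e | e \<in> arcs G \<and> k \<in> crossed_gaps r G e. gap k powr p)"
    by (rule sum.swap_restrict) auto
  finally show ?thesis
    by simp
qed

lemma arc_energy_ge_gap_sum:
  assumes e: "e \<in> arcs G"
  shows "(\<Sum>k\<in>crossed_gaps r G e. gap k powr p) \<le> \<bar>f (tail G e) - f (head G e)\<bar> powr p"
  unfolding difference_eq_sum_gaps[OF e]
proof (rule sum_powr_le_powr_sum[OF p])
  show "0 \<le> gap k" if "k \<in> crossed_gaps r G e" for k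
    using gap_nonneg crossed_gaps_subset[OF e] that by blast
qed (simp add: crossed_gaps_def)

lemma energy_ge_gap_sum:
  "(\<Sum>e\<in>arcs G. \<Sum>k\<in>crossed_gaps r G e. gap k powr p) \<le> edge_energy p G f"
  unfolding edge_energy_def by (intro sum_mono arc_energy_ge_gap_sum)

lemma energy_path_eq:
  "edge_energy p (path_graph n) g = (\<Sum>k\<in>{1..<n}. gap k powr p)"
  unfolding edge_energy_path_graph using gap_nonneg by (intro sum.cong) auto

lemma gap_sum_ge_energy_path:
  "real (edge_connectivity G) * edge_energy p (path_graph n) g \<le>
   (\<Sum>e\<in>arcs G. \<Sum>k\<in>crossed_gaps r G e. gap k powr p)"
  unfolding energy_path_eq sum_gaps_eq_sum_crossings sum_distrib_left
  by (intro sum_mono mult_right_mono) (use edge_connectivity_le_crossings in auto)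

lemma energy_ge_energy_path:
  "real (edge_connectivity G) * edge_energy p (path_graph n) g \<le> edge_energy p G f"
  using energy_ge_gap_sum gap_sum_ge_energy_path by linarith

text \<open>
  Equality in a sum of inequalities forces equality in each of them. For a gap, whose \<open>p\<close>-th power is
  positive, it fixes the number of crossing edges; for an edge, it excludes two or more crossed gaps by
  strict superadditivity. As there are no loops, every edge crosses exactly one gap \<open>\<kappa> e\<close>, and the rank
  together with a numbering of the edges over each gap is the isomorphism.
\<close>
lemma is_pumpkin_chain_of_energy_eq:
  assumes eq: "edge_energy p G f = real (edge_connectivity G) * edge_energy p (path_graph n) g"
    and strict: "\<And>k. k \<in> {1..<n} \<Longrightarrow> g k < g (Suc k)"
  shows "is_pumpkin_chain (edge_connectivity G) G"
proof -
  let ?\<eta> = "edge_connectivity G"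
  let ?C = "\<lambda>k. {e \<in> arcs G. k \<in> crossed_gaps r G e}"
  have 1: "edge_energy p G f = (\<Sum>e\<in>arcs G. \<Sum>k\<in>crossed_gaps r G e. gap k powr p)"
    and 2: "(\<Sum>k\<in>{1..<n}. real (card (?C k)) * gap k powr p) = (\<Sum>k\<in>{1..<n}. real ?\<eta> * gap k powr p)"
    using eq energy_ge_gap_sum gap_sum_ge_energy_path
    unfolding energy_path_eq sum_gaps_eq_sum_crossings sum_distrib_left by linarith+
  have cut: "card (?C k) = ?\<eta>" if k: "k \<in> {1..<n}" for k
  proof -
    have "real ?\<eta> * gap k powr p = real (card (?C k)) * gap k powr p"
      by (rule sum_mono_inv[OF 2[symmetric] _ k])
         (use edge_connectivity_le_crossings in \<open>auto intro!: mult_right_mono\<close>)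
    then show ?thesis
      using strict[OF k] by simp
  qed
  have single: "\<exists>k\<in>{1..<n}. crossed_gaps r G e = {k}" if e: "e \<in> arcs G" for e
  proof -
    have sub: "crossed_gaps r G e \<subseteq> {1..<n}"
      using crossed_gaps_subset[OF e] .
    have "r (tail G e) \<noteq> r (head G e)"
      using e no_loops[OF e] bij_betw_imp_inj_on[OF r] by (auto dest: inj_onD)
    then have "crossed_gaps r G e \<noteq> {}"
      by (auto simp: crossed_gaps_def)
    moreover have "\<not> 2 \<le> card (crossed_gaps r G e)"
    proof
      assume "2 \<le> card (crossed_gaps r G e)"
      moreover have "0 < gap k" if "k \<in> crossed_gaps r G e" for k
        using strict[of k] sub that by auto
      ultimately have "(\<Sum>k\<in>crossed_gaps r G e. gap k powr p) < (\<Sum>k\<in>crossed_gaps r G e. gap k) powr p"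
        by (intro sum_powr_less_powr_sum p) (auto simp: crossed_gaps_def)
      moreover have "(\<Sum>k\<in>crossed_gaps r G e. gap k powr p) = \<bar>f (tail G e) - f (head G e)\<bar> powr p"
        by (rule sum_mono_inv[OF 1[symmetric, unfolded edge_energy_def]])
           (use e arc_energy_ge_gap_sum in auto)
      ultimately show False
        using difference_eq_sum_gaps[OF e] by simp
    qed
    moreover have "finite (crossed_gaps r G e)"
      by (simp add: crossed_gaps_def)
    ultimately have "card (crossed_gaps r G e) \<noteq> 0" "\<not> 2 \<le> card (crossed_gaps r G e)"
      by simp_all
    then have "card (crossed_gaps r G e) = 1"
      by linarith
    then obtain k where "crossed_gaps r G e = {k}"
      using card_1_singletonE by blast
    then show ?thesis
      using sub by auto
  qed
  then obtain \<kappa> where \<kappa>: "\<And>e. e \<in> arcs G \<Longrightarrow> \<kappa> e \<in> {1..<n}"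
      "\<And>e. e \<in> arcs G \<Longrightarrow> crossed_gaps r G e = {\<kappa> e}"
    by metis
  have "card {e \<in> arcs G. \<kappa> e = k} = ?\<eta>" if k: "k \<in> {1..<n}" for k
  proof -
    have "{e \<in> arcs G. \<kappa> e = k} = ?C k"
      using \<kappa>(2) by auto
    then show ?thesis
      using cut[OF k] by simp
  qed
  then obtain \<beta> where "bij_betw (\<lambda>e. (\<kappa> e, \<beta> e)) (arcs G) ({1..<n} \<times> {1..?\<eta>})"
    using ex_bij_betw_Times_of_equal_fibres[of "arcs G" \<kappa> "{1..<n}" ?\<eta>] finite_arcs \<kappa>(1) by blast
  moreover have "{r (tail G e), r (head G e)} = {\<kappa> e, Suc (\<kappa> e)}" if e: "e \<in> arcs G" for e
  proof -
    define i j where "i = min (r (tail G e)) (r (head G e))" and "j = max (r (tail G e)) (r (head G e))"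
    have ij: "{i..<j} = {\<kappa> e}"
      using \<kappa>(2)[OF e] by (simp add: crossed_gaps_def i_def j_def)
    then have "i < j"
      by (metis atLeastLessThan_empty_iff insert_not_empty)
    then have "i \<in> {i..<j}" "j - 1 \<in> {i..<j}"
      by auto
    then have "i = \<kappa> e" "j - 1 = \<kappa> e"
      unfolding ij by auto
    then have "i = \<kappa> e" "j = Suc (\<kappa> e)"
      using \<open>i < j\<close> by auto
    moreover have "{r (tail G e), r (head G e)} = {i, j}"
      by (auto simp: i_def j_def min_def max_def)
    ultimately show ?thesis by simp
  qed
  ultimately have "multigraph_iso G (pumpkin_chain ?\<eta> n)"
    unfolding multigraph_iso_def
    by (intro exI[of _ r] exI[of _ "\<lambda>e. (\<kappa> e, \<beta> e)"])
       (use r in \<open>auto simp: pumpkin_chain_def replace_edges_parallel_def path_graph_def\<close>)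
  then show ?thesis
    by (simp add: is_pumpkin_chain_def card)
qed

end

end

theorem theorem2p3:
  fixes G :: "('a, 'b) pre_digraph" and p :: real
  assumes "combinatorial_graph G"
    and "card (verts G) \<ge> 2"
    and "p > 1"
  shows "gamma1 p G \<ge> gamma1 p (pumpkin_chain (edge_connectivity G) (card (verts G))) \<and>
         gamma1 p (pumpkin_chain (edge_connectivity G) (card (verts G)))
           = real (edge_connectivity G) * gamma1 p (path_graph (card (verts G))) \<and>
         (gamma1 p G = gamma1 p (pumpkin_chain (edge_connectivity G) (card (verts G)))
           \<longleftrightarrow> is_pumpkin_chain (edge_connectivity G) G)"
proof -
  interpret combinatorial_graph G by (rule assms(1))
  define n where "n = card (verts G)"
  define \<eta> where "\<eta> = edge_connectivity G"
  let ?P = "path_graph n" and ?H = "pumpkin_chain \<eta> n"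
  have p: "p > 0" using assms(3) by simp
  have n: "2 \<le> n" using assms(2) by (simp add: n_def)
  have \<eta>: "1 \<le> \<eta>"
    unfolding \<eta>_def using assms(2) connected_graph by (intro edge_connectivity_pos) auto
  have chain: "gamma1 p ?H = real \<eta> * gamma1 p ?P"
    unfolding pumpkin_chain_def
    by (rule gamma1_replace_edges_parallel) (use n p wf_digraph_path_graph in auto)
  have path: "gamma1 p ?P * deviation p {1..n} g \<le> edge_energy p ?P g"
    if "nonconst_on {1..n} g" for g
    using gamma1_mult_deviation_le[of ?P p g] that p by simp
  have lower: "real \<eta> * gamma1 p ?P \<le> gamma1 p G"
  proof (rule gamma1_greatest)
    fix f assume nc: "nonconst_on (verts G) f"
    obtain r g where r: "bij_betw r (verts G) {1..n}" and g: "mono_on {1..n} g"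
      and f: "\<And>v. v \<in> verts G \<Longrightarrow> f v = g (r v)"
      using ex_monotone_ranking[of "verts G" f] n_def by auto
    have "nonconst_on {1..n} g"
      using nonconst_on_reindex[OF r, of f g] f nc by blast
    then have "real \<eta> * (gamma1 p ?P * deviation p {1..n} g) \<le> real \<eta> * edge_energy p ?P g"
      by (intro mult_left_mono path) auto
    also have "\<dots> \<le> edge_energy p G f"
      unfolding \<eta>_def
      by (rule energy_ge_energy_path[OF assms(1) n_def[symmetric] r g f assms(3)])
    finally show "real \<eta> * gamma1 p ?P * deviation p (verts G) f \<le> edge_energy p G f"
      using deviation_reindex[OF r, of f g p] f by (simp add: mult.assoc)
  qed (use assms(2) p in auto)
  have "is_pumpkin_chain \<eta> G" if eq: "gamma1 p G = gamma1 p ?H"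
  proof -
    obtain f where nc: "nonconst_on (verts G) f"
      and min: "edge_energy p G f = gamma1 p G * deviation p (verts G) f"
      using gamma1_attained[OF _ assms(2) p wf_digraph_axioms] by auto
    obtain r g where r: "bij_betw r (verts G) {1..n}" and g: "mono_on {1..n} g"
      and f: "\<And>v. v \<in> verts G \<Longrightarrow> f v = g (r v)"
      using ex_monotone_ranking[of "verts G" f] n_def by auto
    have ncg: "nonconst_on {1..n} g"
      using nonconst_on_reindex[OF r, of f g] f nc by blast
    have "real \<eta> * edge_energy p ?P g \<le> edge_energy p G f"
      unfolding \<eta>_def
      by (rule energy_ge_energy_path[OF assms(1) n_def[symmetric] r g f assms(3)])
    also have minG: "edge_energy p G f = real \<eta> * (gamma1 p ?P * deviation p {1..n} g)"
      using min deviation_reindex[OF r, of f g p] f by (simp add: eq chain)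
    finally have ge: "edge_energy p ?P g \<le> gamma1 p ?P * deviation p {1..n} g"
      using \<eta> by simp
    then have minP: "edge_energy p ?P g = gamma1 p ?P * deviation p {1..n} g"
      using path[OF ncg] by simp
    show ?thesis
      unfolding \<eta>_def
    proof (rule is_pumpkin_chain_of_energy_eq[OF assms(1) n_def[symmetric] r g f assms(3)])
      show "edge_energy p G f = real (edge_connectivity G) * edge_energy p ?P g"
        using minG minP by (simp add: \<eta>_def)
      show "g k < g (Suc k)" if "k \<in> {1..<n}" for k
        by (rule path_minimizer_strictly_increasing[OF assms(3) g ncg minP that])
    qed
  qed
  moreover have "gamma1 p G = gamma1 p ?H" if "is_pumpkin_chain \<eta> G"
  proof (rule antisym)
    show "gamma1 p G \<le> gamma1 p ?H"
      using that unfolding is_pumpkin_chain_def n_def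
      by (rule gamma1_le_of_multigraph_iso) (use assms(2) p in auto)
    show "gamma1 p ?H \<le> gamma1 p G"
      using lower chain by simp
  qed
  ultimately show ?thesis
    using lower chain unfolding \<eta>_def n_def by auto
qed

end
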